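(* Let $\mathfrak g$ be a unimodular Lie algebra admitting a conformally flat LCP structure. Then every closed non-zero 1-form $\theta$ on $\mathfrak g$ is the Lee form of a conformally flat LCP structure on $\mathfrak g$; that is, there exists an inner product $g$ on $\mathfrak g$ such that $(g,\theta)$ is a conformally flat LCP structure on $\mathfrak g$.
   Context: All Lie algebras are real and finite-dimensional. Let $\mathfrak g$ be a Lie algebra with an inner product $g$. For $x\in\mathfrak g$, $\nabla^g_x\in\mathfrak{so}(\mathfrak g)$ is given by $g(\nabla^g_xy,z)=\frac12\big(g([x,y],z)-g([x,z],y)-g([y,z],x)\big)$. For $\theta\in\mathfrak g^*$ with $g$-dual vector $\theta^\sharp$, set $\nabla^\theta_xy:=\nabla^g_xy+\theta(x)y+\theta(y)x-g(x,y)\theta^\sharp$. A 1-form $\theta\in\mathfrak g^*$ is closed if it vanishes on $\mathfrak g'=[\mathfrak g,\mathfrak g]$. A subspace $\mathfrak u\subset\mathfrak g$ is $\nabla^\theta$-flat if $\nabla^\theta_x\mathfrak u\subset\mathfrak u$ for all $x\in\mathfrak g$ and $x\mapsto\nabla^\theta_x|_{\mathfrak u}$ is a Lie algebra representation $\mathfrak g\to\mathfrak{gl}(\mathfrak u)$. An LCP structure on $\mathfrak g$ is a triple $(g,\theta,\mathfrak u)$ with $g$ an inner product, $\theta\ne0$ a closed 1-form (its Lee form) and $\mathfrak u\neq0$ a $\nabla^\theta$-flat subspace. It is conformally flat if $\mathfrak u=\mathfrak g$, and then it is denoted $(g,\theta)$. A Lie algebra $\mathfrak g$ is unimodular if $\mathrm{tr}(\mathrm{ad}_x)=0$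 for all $x\in\mathfrak g$. *)

theory Defs
  imports "HOL-Analysis.Analysis"
begin

text \<open>
  A real finite-dimensional Lie algebra is a bracket on a type of class euclidean_space.
  The class is used only as the library's notion of a finite-dimensional real vector space;
  its built-in inner product plays no role except to read off coordinates in the definition
  of the trace.  The inner products of the theory are explicit functions \<open>g\<close>.
\<close>

definition lie_algebra :: "('a::euclidean_space \<Rightarrow> 'a \<Rightarrow> 'a) \<Rightarrow> bool" where
  "lie_algebra br \<longleftrightarrow>
     bilinear br \<and> (\<forall>x. br x x = 0) \<and>
     (\<forall>x y z. br x (br y z) + br y (br z x) + br z (br x y) = 0)"

definition lin_trace :: "('a::euclidean_space \<Rightarrow> 'a) \<Rightarrow> real" where
  "lin_trace f = (\<Sum>b\<in>Basis. f b \<bullet> b)"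

definition unimodular :: "('a::euclidean_space \<Rightarrow> 'a \<Rightarrow> 'a) \<Rightarrow> bool" where
  "unimodular br \<longleftrightarrow> (\<forall>x. lin_trace (\<lambda>y. br x y) = 0)"

definition derived_algebra :: "('a::euclidean_space \<Rightarrow> 'a \<Rightarrow> 'a) \<Rightarrow> 'a set" where
  "derived_algebra br = span {br x y | x y. True}"

definition closed_form :: "('a::euclidean_space \<Rightarrow> 'a \<Rightarrow> 'a) \<Rightarrow> ('a \<Rightarrow> real) \<Rightarrow> bool" where
  "closed_form br \<theta> \<longleftrightarrow> linear \<theta> \<and> (\<forall>v\<in>derived_algebra br. \<theta> v = 0)"

definition inner_product :: "('a::euclidean_space \<Rightarrow> 'a \<Rightarrow> real) \<Rightarrow> bool" where
  "inner_product g \<longleftrightarrow>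
     bilinear g \<and> (\<forall>x y. g x y = g y x) \<and> (\<forall>x. x \<noteq> 0 \<longrightarrow> 0 < g x x)"

definition sharp :: "('a::euclidean_space \<Rightarrow> 'a \<Rightarrow> real) \<Rightarrow> ('a \<Rightarrow> real) \<Rightarrow> 'a" where
  "sharp g \<phi> = (THE v. \<forall>z. g v z = \<phi> z)"

lemma sharp_ex1:
  fixes g :: "'a::euclidean_space \<Rightarrow> 'a \<Rightarrow> real"
  assumes g: "inner_product g" and \<phi>: "linear \<phi>"
  shows "\<exists>!v. \<forall>z. g v z = \<phi> z"
proof -
  have bil: "bilinear g" and pos: "\<And>x. x \<noteq> 0 \<Longrightarrow> 0 < g x x"
    using g by (auto simp: inner_product_def)
  have lin1: "linear (\<lambda>v. g v z)" and lin2: "linear (g v)" for v z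
    using bil by (auto simp: bilinear_def)
  define T where "T v = (\<Sum>b\<in>Basis. g v b *\<^sub>R b)" for v
  have "linear T"
    unfolding T_def
    by (rule linearI)
      (simp_all add: linear_add[OF lin1] linear_scale[OF lin1] scaleR_add_left sum.distrib
        scaleR_sum_right)
  have coord: "T v \<bullet> b = g v b" if "b \<in> Basis" for v b
    using that by (simp add: T_def)
  have eqI: "g v = \<psi>" if "linear \<psi>" "\<And>b. b \<in> Basis \<Longrightarrow> g v b = \<psi> b" for v \<psi>
    using linear_eq_stdbasis[OF lin2 that(1)] that(2) by blast
  have "inj T"
  proof (subst linear_injective_0[OF \<open>linear T\<close>], intro allI impI)
    fix v assume "T v = 0"
    then have "g v b = 0" if "b \<in> Basis" for b using coord[OF that, of v] by simp
    then have "g v = (\<lambda>_. 0)" by (intro eqI) (auto intro: linear_zero)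
    then show "v = 0" using pos[of v] by force
  qed
  then have "surj T" using linear_inj_imp_surj \<open>linear T\<close> by blast
  then obtain v where v: "T v = (\<Sum>b\<in>Basis. \<phi> b *\<^sub>R b)" by (metis surjD)
  have "g v = \<phi>" using coord[of _ v] by (intro eqI \<phi>) (simp add: v)
  moreover have "w = v" if "g w = \<phi>" for w
    using that \<open>g v = \<phi>\<close> \<open>inj T\<close> by (auto simp: T_def inj_def)
  ultimately show ?thesis by (metis ext)
qed

lemma sharp_eq:
  assumes "inner_product g" and "linear \<phi>"
  shows "g (sharp g \<phi>) z = \<phi> z"
  using theI'[OF sharp_ex1[OF assms]] unfolding sharp_def by blast

definition levi_civita ::
  "('a::euclidean_space \<Rightarrow> 'a \<Rightarrow> 'a) \<Rightarrow> ('a \<Rightarrow> 'a \<Rightarrow> real) \<Rightarrow> 'a \<Rightarrow> 'a \<Rightarrow> 'a" where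
  "levi_civita br g x y =
     sharp g (\<lambda>z. 1/2 * (g (br x y) z - g (br x z) y - g (br y z) x))"

lemma levi_civita_eq:
  assumes "lie_algebra br" and "inner_product g"
  shows "g (levi_civita br g x y) z = 1/2 * (g (br x y) z - g (br x z) y - g (br y z) x)"
proof -
  have "bilinear br" "bilinear g"
    using assms by (auto simp: lie_algebra_def inner_product_def)
  then have "linear (\<lambda>z. 1/2 * (g (br x y) z - g (br x z) y - g (br y z) x))"
    by (intro linearI)
      (simp_all add: bilinear_ladd bilinear_radd bilinear_lmul bilinear_rmul algebra_simps)
  then show ?thesis
    unfolding levi_civita_def by (rule sharp_eq[OF assms(2)])
qed

definition weyl_connection ::
  "('a::euclidean_space \<Rightarrow> 'a \<Rightarrow> 'a) \<Rightarrow> ('a \<Rightarrow> 'a \<Rightarrow> real) \<Rightarrow> ('a \<Rightarrow> real) \<Rightarrow> 'a \<Rightarrow> 'a \<Rightarrow> 'a" where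
  "weyl_connection br g \<theta> x y =
     levi_civita br g x y + \<theta> x *\<^sub>R y + \<theta> y *\<^sub>R x - g x y *\<^sub>R sharp g \<theta>"

text \<open>
  \<open>\<rho>\<close> need not be linear off \<open>u\<close>: only the restrictions \<open>\<rho> x|u\<close> matter.
\<close>

definition lie_representation_on ::
  "('a::euclidean_space \<Rightarrow> 'a \<Rightarrow> 'a) \<Rightarrow> 'a set \<Rightarrow> ('a \<Rightarrow> 'a \<Rightarrow> 'a) \<Rightarrow> bool" where
  "lie_representation_on br u \<rho> \<longleftrightarrow>
     (\<forall>x. \<forall>v\<in>u. \<rho> x v \<in> u) \<and>
     (\<forall>x. \<forall>v\<in>u. \<forall>w\<in>u. \<rho> x (v + w) = \<rho> x v + \<rho> x w) \<and>
     (\<forall>x c. \<forall>v\<in>u. \<rho> x (c *\<^sub>R v) = c *\<^sub>R \<rho> x v) \<and>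
     (\<forall>v\<in>u. linear (\<lambda>x. \<rho> x v)) \<and>
     (\<forall>x y. \<forall>v\<in>u. \<rho> (br x y) v = \<rho> x (\<rho> y v) - \<rho> y (\<rho> x v))"

definition weyl_flat ::
  "('a::euclidean_space \<Rightarrow> 'a \<Rightarrow> 'a) \<Rightarrow> ('a \<Rightarrow> 'a \<Rightarrow> real) \<Rightarrow> ('a \<Rightarrow> real) \<Rightarrow> 'a set \<Rightarrow> bool" where
  "weyl_flat br g \<theta> u \<longleftrightarrow>
     subspace u \<and> lie_representation_on br u (weyl_connection br g \<theta>)"

definition lcp_structure ::
  "('a::euclidean_space \<Rightarrow> 'a \<Rightarrow> 'a) \<Rightarrow> ('a \<Rightarrow> 'a \<Rightarrow> real) \<Rightarrow> ('a \<Rightarrow> real) \<Rightarrow> 'a set \<Rightarrow> bool" where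
  "lcp_structure br g \<theta> u \<longleftrightarrow>
     inner_product g \<and> closed_form br \<theta> \<and> \<theta> \<noteq> (\<lambda>_. 0) \<and> u \<noteq> {0} \<and> weyl_flat br g \<theta> u"

definition conformally_flat_lcp_structure ::
  "('a::euclidean_space \<Rightarrow> 'a \<Rightarrow> 'a) \<Rightarrow> ('a \<Rightarrow> 'a \<Rightarrow> real) \<Rightarrow> ('a \<Rightarrow> real) \<Rightarrow> bool" where
  "conformally_flat_lcp_structure br g \<theta> \<longleftrightarrow> lcp_structure br g \<theta> UNIV"

end

theory Submission
  imports Defs
begin

text \<open>
  For a conformally flat structure \<open>(g, \<theta>)\<close> the operators \<open>L x = \<nabla>\<^sup>\<theta>\<^sub>x\<close> form a representation by
  elements of \<open>\<real> \<oplus> so(g)\<close> that is torsion-free, so \<open>b x = x - L x e\<close> is a cocycle for every \<open>e\<close>.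
  Fix \<open>a\<close> with \<open>\<theta> a \<noteq> 0\<close>; then \<open>L a\<close> is invertible, and \<open>e\<close> is chosen with \<open>L a e = a\<close>, so that \<open>b a = 0\<close> and
  \<open>b [a, x] = L a (b x)\<close>.  The form \<open>B x y = tr ((L x)\<^sup>* (L y))\<close> is ad-invariant and
  \<open>g (b x) (b y) + B x y\<close> is positive definite.  With respect to an orthonormal basis \<open>E\<close> of the
  latter, \<open>tr (ad a) = \<theta> a * (\<Sum>v\<in>E. g (b v) (b v))\<close>, so unimodularity forces \<open>b = 0\<close> and \<open>B\<close> itself is
  an ad-invariant inner product.  Hence \<open>B\<close>-duals of closed forms are central, which provides for
  any two non-zero closed forms \<open>\<theta>\<close>, \<open>\<theta>'\<close> a central \<open>c\<close> with \<open>\<theta> c = 1\<close> and \<open>\<theta>' c \<noteq> 0\<close>.  Then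
  \<open>x \<mapsto> x + (\<theta>' x - \<theta> x) c\<close> is an automorphism pulling \<open>\<theta>\<close> back to \<open>\<theta>'\<close>, and it
  pulls \<open>g\<close> back to the required inner product.
\<close>

section \<open>Inner products, orthonormal bases and the trace\<close>

lemma inner_product_bilinear: "inner_product g \<Longrightarrow> bilinear g"
  and inner_product_sym: "inner_product g \<Longrightarrow> g x y = g y x"
  and inner_product_pos: "inner_product g \<Longrightarrow> x \<noteq> 0 \<Longrightarrow> 0 < g x x"
  unfolding inner_product_def by blast+

lemma inner_product_nonneg: "inner_product g \<Longrightarrow> 0 \<le> g x x"
  using inner_product_pos[of g x] bilinear_lzero[OF inner_product_bilinear, of g 0]
  by (cases "x = 0") auto

lemma inner_product_eqI:
  assumes g: "inner_product g" and eq: "\<And>z. g x z = g y z"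
  shows "x = y"
proof (rule ccontr)
  assume "x \<noteq> y"
  then have "0 < g (x - y) (x - y)"
    by (intro inner_product_pos[OF g]) simp
  then show False
    by (simp add: bilinear_lsub[OF inner_product_bilinear[OF g]] eq)
qed

lemma bilinear_sum_left:
  fixes g :: "'a::euclidean_space \<Rightarrow> 'b::euclidean_space \<Rightarrow> 'c::real_vector"
  shows "bilinear g \<Longrightarrow> g (\<Sum>i\<in>I. f i) y = (\<Sum>i\<in>I. g (f i) y)"
  by (rule linear_sum) (simp add: bilinear_def)

lemma bilinear_sum_right:
  fixes g :: "'a::euclidean_space \<Rightarrow> 'b::euclidean_space \<Rightarrow> 'c::real_vector"
  shows "bilinear g \<Longrightarrow> g x (\<Sum>i\<in>I. f i) = (\<Sum>i\<in>I. g x (f i))"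
  by (rule linear_sum) (simp add: bilinear_def)

text \<open>Spanning is kept apart: where needed, it is expressed by the expansion of every vector
  in \<open>E\<close>.\<close>

definition orthonormal :: "('a::euclidean_space \<Rightarrow> 'a \<Rightarrow> real) \<Rightarrow> 'a set \<Rightarrow> bool" where
  "orthonormal g E \<longleftrightarrow> finite E \<and> (\<forall>u\<in>E. \<forall>v\<in>E. g u v = (if u = v then 1 else 0))"

lemma orthonormal_coeff:
  assumes g: "bilinear g" and E: "orthonormal g E" and v: "v \<in> E"
  shows "g (\<Sum>u\<in>E. c u *\<^sub>R u) v = c v"
proof -
  have "g (\<Sum>u\<in>E. c u *\<^sub>R u) v = (\<Sum>u\<in>E. c u * g u v)"
    by (simp add: bilinear_sum_left[OF g] bilinear_lmul[OF g])
  also have "\<dots> = (\<Sum>u\<in>E. if u = v then c u else 0)"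
    using E v by (intro sum.cong) (auto simp: orthonormal_def)
  finally show ?thesis
    using E v by (simp add: orthonormal_def)
qed

lemma orthonormal_independent:
  assumes g: "bilinear g" and E: "orthonormal g E"
  shows "independent E"
proof (rule independent_if_scalars_zero)
  fix f v assume "(\<Sum>u\<in>E. f u *\<^sub>R u) = 0" and "v \<in> E"
  with orthonormal_coeff[OF g E, of v f] show "f v = 0"
    by (simp add: bilinear_lzero[OF g])
qed (use E in \<open>simp add: orthonormal_def\<close>)

text \<open>An orthonormal set of maximal cardinality spans: otherwise the normalised remainder of
  some expansion would enlarge it.\<close>

lemma orthonormal_basis_exists:
  fixes g :: "'a::euclidean_space \<Rightarrow> 'a \<Rightarrow> real"
  assumes g: "inner_product g"
  obtains E where "orthonormal g E" and "\<And>x. x = (\<Sum>v\<in>E. g x v *\<^sub>R v)"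
proof -
  note bil = inner_product_bilinear[OF g]
  define E where "E = (ARG_MAX card E. orthonormal g E)"
  have "orthonormal g {}"
    by (simp add: orthonormal_def)
  \<comment> \<open>Orthonormal sets are independent, so their cardinality is bounded and the
    maximum is attained; \<open>Suc\<close> makes the bound strict.\<close>
  moreover have "\<forall>F. orthonormal g F \<longrightarrow> card F < Suc DIM('a)"
    using orthonormal_independent[OF bil] independent_bound le_imp_less_Suc by blast
  ultimately have E: "orthonormal g E" and max: "\<And>F. orthonormal g F \<Longrightarrow> card F \<le> card E"
    unfolding E_def by (blast intro: arg_max_nat_lemma[THEN conjunct1] arg_max_nat_le)+
  have "x = (\<Sum>v\<in>E. g x v *\<^sub>R v)" for x
  proof (rule ccontr)
    define y where "y = x - (\<Sum>v\<in>E. g x v *\<^sub>R v)"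
    define z where "z = (1 / sqrt (g y y)) *\<^sub>R y"
    assume "x \<noteq> (\<Sum>v\<in>E. g x v *\<^sub>R v)"
    then have pos: "0 < g y y"
      by (intro inner_product_pos[OF g]) (simp add: y_def)
    have "g y v = 0" if "v \<in> E" for v
      using orthonormal_coeff[OF bil E that] by (simp add: y_def bilinear_lsub[OF bil])
    then have zv: "g z v = 0" if "v \<in> E" for v
      using that by (simp add: z_def bilinear_lmul[OF bil])
    have zz: "g z z = 1"
      using pos by (simp add: z_def bilinear_lmul[OF bil] bilinear_rmul[OF bil])
    have vz: "g v z = 0" if "v \<in> E" for v
      using zv[OF that] inner_product_sym[OF g, of v z] by simp
    have "orthonormal g (insert z E)"
      using E zv vz zz by (auto simp: orthonormal_def)
    moreover have "z \<notin> E"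
      using zv zz by force
    ultimately show False
      using max[of "insert z E"] E by (simp add: orthonormal_def)
  qed
  with E that show thesis by blast
qed

text \<open>The expansion writes \<open>f\<close> as a sum of rank-one maps sending x to
  \<open>g (f x) v *\<^sub>R v\<close>; each has trace \<open>g (f v) v\<close>.\<close>

lemma lin_trace_orthonormal:
  fixes f :: "'a::euclidean_space \<Rightarrow> 'a"
  assumes g: "bilinear g" and f: "linear f"
    and expand: "\<And>x. x = (\<Sum>v\<in>E. g x v *\<^sub>R v)"
  shows "lin_trace f = (\<Sum>v\<in>E. g (f v) v)"
proof -
  have "lin_trace f = (\<Sum>b\<in>Basis. \<Sum>v\<in>E. g (f b) v * (v \<bullet> b))"
    unfolding lin_trace_def
    by (rule sum.cong[OF refl], subst expand) (simp add: inner_sum_left)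
  also have "\<dots> = (\<Sum>v\<in>E. \<Sum>b\<in>Basis. g (f b) v * (v \<bullet> b))"
    by (rule sum.swap)
  also have "\<dots> = (\<Sum>v\<in>E. g (f (\<Sum>b\<in>Basis. (v \<bullet> b) *\<^sub>R b)) v)"
    by (simp add: linear_sum[OF f] linear_scale[OF f] bilinear_sum_left[OF g]
        bilinear_lmul[OF g] mult.commute)
  finally show ?thesis
    by (simp add: euclidean_representation)
qed

section \<open>Closed forms, brackets and the Weyl connection\<close>

lemma closed_form_linear: "closed_form br \<theta> \<Longrightarrow> linear \<theta>"
  and closed_form_bracket: "closed_form br \<theta> \<Longrightarrow> \<theta> (br x y) = 0"
  by (auto simp: closed_form_def derived_algebra_def intro!: span_base)

lemma lie_algebra_antisym:
  assumes "lie_algebra br"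
  shows "br x y = - br y x"
proof -
  have bil: "bilinear br" and alt: "\<And>x. br x x = 0"
    using assms by (auto simp: lie_algebra_def)
  have "br x y + br y x = 0"
    using alt[of x] alt[of y] alt[of "x + y"]
    by (simp add: bilinear_ladd[OF bil] bilinear_radd[OF bil] add.commute)
  then show ?thesis
    by (simp add: eq_neg_iff_add_eq_0)
qed

lemma weyl_connection_eq:
  assumes br: "lie_algebra br" and g: "inner_product g" and \<theta>: "linear \<theta>"
  shows "g (weyl_connection br g \<theta> x y) z =
    1/2 * (g (br x y) z - g (br x z) y - g (br y z) x)
      + \<theta> x * g y z + \<theta> y * g x z - g x y * \<theta> z"
proof -
  note bil = inner_product_bilinear[OF g]
  show ?thesis
    by (simp only: weyl_connection_def bilinear_ladd[OF bil] bilinear_lsub[OF bil]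
        bilinear_lmul[OF bil] levi_civita_eq[OF br g] sharp_eq[OF g \<theta>] real_scaleR_def)
qed

section \<open>Left-symmetric products whose left multiplications are infinitesimal
  similarities\<close>

locale conformal_left_symmetric =
  fixes br :: "'a::euclidean_space \<Rightarrow> 'a \<Rightarrow> 'a"
    and g :: "'a \<Rightarrow> 'a \<Rightarrow> real" and \<theta> :: "'a \<Rightarrow> real" and L :: "'a \<Rightarrow> 'a \<Rightarrow> 'a"
  assumes g: "inner_product g"
    and bilinear_L: "bilinear L"
    and torsion_free: "L x y - L y x = br x y"
    and conformal: "g (L x y) z + g y (L x z) = 2 * \<theta> x * g y z"
    and representation: "L (br x y) z = L x (L y z) - L y (L x z)"
begin

lemmas bil = inner_product_bilinear[OF g]
lemmas g_simps = bilinear_ladd[OF bil] bilinear_radd[OF bil] bilinear_lmul[OF bil]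
  bilinear_rmul[OF bil] bilinear_lsub[OF bil] bilinear_rsub[OF bil]
lemmas L_simps = bilinear_ladd[OF bilinear_L] bilinear_radd[OF bilinear_L]
  bilinear_lmul[OF bilinear_L] bilinear_rmul[OF bilinear_L]
  bilinear_lsub[OF bilinear_L] bilinear_rsub[OF bilinear_L]

lemma linear_L: "linear (L x)"
  using bilinear_L by (simp add: bilinear_def)

lemma conformal_diag: "g (L x y) y = \<theta> x * g y y"
  using conformal[of x y y] inner_product_sym[OF g, of y "L x y"] by simp

text \<open>The symmetric part of \<open>L x\<close> is \<open>\<theta> x\<close> times the
  identity, so a non-zero \<open>\<theta> x\<close> leaves no kernel.\<close>

lemma surj_L:
  assumes "\<theta> x \<noteq> 0"
  shows "surj (L x)"
proof (rule linear_inj_imp_surj[OF linear_L])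
  have "y = 0" if "L x y = 0" for y
    using conformal_diag[of x y] that assms inner_product_pos[OF g, of y]
    by (auto simp: bilinear_lzero[OF bil])
  then show "inj (L x)"
    by (simp add: linear_injective_0[OF linear_L])
qed

text \<open>The Hilbert-Schmidt product of \<open>L x\<close> and \<open>L y\<close> when
  \<open>E\<close> is a \<open>g\<close>-orthonormal basis.\<close>

definition hs_form :: "'a set \<Rightarrow> 'a \<Rightarrow> 'a \<Rightarrow> real" where
  "hs_form E x y = (\<Sum>v\<in>E. g (L x v) (L y v))"

lemma bilinear_hs_form: "bilinear (hs_form E)"
  unfolding bilinear_def
  by (auto intro!: linearI
      simp: hs_form_def g_simps L_simps sum.distrib sum_distrib_left)

lemma hs_form_sym: "hs_form E x y = hs_form E y x"
  by (simp add: hs_form_def inner_product_sym[OF g])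

lemma hs_form_nonneg: "0 \<le> hs_form E x x"
  by (simp add: hs_form_def sum_nonneg inner_product_nonneg[OF g])

lemma hs_form_eq_0:
  assumes E: "finite E" and expand: "\<And>x. x = (\<Sum>v\<in>E. g x v *\<^sub>R v)"
    and zero: "hs_form E x x = 0"
  shows "L x y = 0"
proof -
  have "L x v = 0" if "v \<in> E" for v
    using zero that inner_product_pos[OF g, of "L x v"]
    by (force simp: hs_form_def sum_nonneg_eq_0_iff[OF E] inner_product_nonneg[OF g])
  then show ?thesis
    by (subst expand[of y]) (simp add: linear_sum[OF linear_L] linear_scale[OF linear_L])
qed

text \<open>Since \<open>L x\<close> is \<open>\<theta> x\<close> plus a skew map, composing with it
  on the left and on the right both act on the Hilbert-Schmidt product by the factor
  \<open>2 * \<theta> x\<close>. These contributions cancel in the commutators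
  \<open>L (br x y)\<close> and \<open>L (br x z)\<close>.\<close>

lemma hs_form_invariant:
  assumes E: "orthonormal g E" and expand: "\<And>x. x = (\<Sum>v\<in>E. g x v *\<^sub>R v)"
  shows "hs_form E (br x y) z + hs_form E y (br x z) = 0"
proof -
  have fin: "finite E" using E by (simp add: orthonormal_def)
  have "(\<Sum>v\<in>E. g (L y (L x v)) (L z v) + g (L y v) (L z (L x v)))
     = (\<Sum>v\<in>E. \<Sum>w\<in>E. g (L x v) w * g (L y w) (L z v))
       + (\<Sum>v\<in>E. \<Sum>w\<in>E. g (L x v) w * g (L y v) (L z w))"
    (is "?lhs = _")
  proof -
    have 1: "L y (L x v) = (\<Sum>w\<in>E. g (L x v) w *\<^sub>R L y w)" for y v
      by (subst expand[of "L x v"])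
        (simp add: linear_sum[OF linear_L] linear_scale[OF linear_L])
    show ?thesis
      by (simp add: 1 sum.distrib bilinear_sum_left[OF bil] bilinear_sum_right[OF bil]
          bilinear_lmul[OF bil] bilinear_rmul[OF bil])
  qed
  \<comment> \<open>Exchanging v and w moves \<open>L x\<close> to the other argument of its
    coefficient, so that \<open>conformal\<close> evaluates the sum of both coefficients.\<close>
  also have "(\<Sum>v\<in>E. \<Sum>w\<in>E. g (L x v) w * g (L y v) (L z w))
     = (\<Sum>v\<in>E. \<Sum>w\<in>E. g v (L x w) * g (L y w) (L z v))"
    by (subst sum.swap) (simp add: inner_product_sym[OF g, of "L x _"])
  also have "(\<Sum>v\<in>E. \<Sum>w\<in>E. g (L x v) w * g (L y w) (L z v)) + \<dots>
     = (\<Sum>v\<in>E. \<Sum>w\<in>E. (2 * \<theta> x * g v w) * g (L y w) (L z v))"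
    by (simp add: sum.distrib[symmetric] distrib_right[symmetric] conformal)
  also have "\<dots> = (\<Sum>v\<in>E. \<Sum>w\<in>E. if v = w then 2 * \<theta> x * g (L y v) (L z v) else 0)"
    using E by (intro sum.cong refl) (auto simp: orthonormal_def)
  also have "\<dots> = 2 * \<theta> x * hs_form E y z"
    using fin by (simp add: hs_form_def sum_distrib_left)
  finally have right: "?lhs = 2 * \<theta> x * hs_form E y z" .
  have left: "(\<Sum>v\<in>E. g (L x (L y v)) (L z v) + g (L y v) (L x (L z v)))
     = 2 * \<theta> x * hs_form E y z"
    by (simp add: conformal hs_form_def sum_distrib_left)
  show ?thesis
    using left right
    by (simp add: hs_form_def representation g_simps sum.distrib sum_subtractf)
qed

text \<open>By \<open>torsion_free\<close>, the identity map is a 1-cocycle for the representation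
  \<open>L\<close>; unimodularity makes it a coboundary.\<close>

lemma right_identity:
  assumes br: "lie_algebra br" and uni: "unimodular br" and a: "\<theta> a \<noteq> 0"
  obtains e where "\<And>x. L x e = x"
proof -
  obtain E where E: "orthonormal g E" and expand: "\<And>x. x = (\<Sum>v\<in>E. g x v *\<^sub>R v)"
    using orthonormal_basis_exists[OF g] by blast
  obtain e where e: "L a e = a"
    using surj_L[OF a] by (metis surjD)
  define b where "b x = x - L x e" for x
  have lin_b: "linear b"
    by (rule linearI) (simp_all add: b_def L_simps algebra_simps)
  have b_bracket: "b (br a x) = L a (b x)" for x
  proof -
    have "b (br a x) = br a x - (L a (L x e) - L x a)"
      by (simp add: b_def representation e)
    then show ?thesis
      using torsion_free[of a x, symmetric] by (simp add: b_def L_simps)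
  qed
  \<comment> \<open>The two semidefinite terms have no common null vector: \<open>b x = 0\<close>
    means \<open>L x e = x\<close>, which forces \<open>L x\<close> to be non-zero for non-zero
    x.\<close>
  define h where "h x y = g (b x) (b y) + hs_form E x y" for x y
  have "inner_product h"
    unfolding inner_product_def
  proof (intro conjI allI impI)
    show "bilinear h"
      unfolding bilinear_def
      by (auto intro!: linearI simp: h_def g_simps linear_add[OF lin_b] linear_scale[OF lin_b]
          bilinear_ladd[OF bilinear_hs_form] bilinear_radd[OF bilinear_hs_form]
          bilinear_lmul[OF bilinear_hs_form] bilinear_rmul[OF bilinear_hs_form] algebra_simps)
    show "h x y = h y x" for x y
      by (simp add: h_def hs_form_sym[of E x y] inner_product_sym[OF g, of "b x"])
    show "0 < h x x" if "x \<noteq> 0" for x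
    proof (cases "b x = 0")
      case True
      then have "L x e \<noteq> 0" using that by (simp add: b_def)
      then have "hs_form E x x \<noteq> 0"
        using hs_form_eq_0[OF _ expand] E by (auto simp: orthonormal_def)
      then show ?thesis
        using hs_form_nonneg[of E x] inner_product_nonneg[OF g, of "b x"]
        by (simp add: h_def)
    next
      case False
      then show ?thesis
        using hs_form_nonneg[of E x] inner_product_pos[OF g] by (simp add: h_def add_pos_nonneg)
    qed
  qed
  then obtain F where F: "orthonormal h F" and expandF: "\<And>x. x = (\<Sum>v\<in>F. h x v *\<^sub>R v)"
    using orthonormal_basis_exists by blast
  \<comment> \<open>The invariant summand contributes nothing on the diagonal; the other one is
    evaluated by \<open>b_bracket\<close> and \<open>conformal_diag\<close>.\<close>
  have diag: "h (br a x) x = \<theta> a * g (b x) (b x)" for x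
    using hs_form_invariant[OF E expand, of a x x] hs_form_sym[of E x]
    by (simp add: h_def b_bracket conformal_diag)
  have "linear (br a)"
    using br by (simp add: lie_algebra_def bilinear_def)
  then have "lin_trace (br a) = (\<Sum>v\<in>F. h (br a v) v)"
    by (rule lin_trace_orthonormal[OF inner_product_bilinear[OF \<open>inner_product h\<close>] _ expandF])
  then have "(\<Sum>v\<in>F. \<theta> a * g (b v) (b v)) = 0"
    using uni by (simp add: unimodular_def diag)
  then have "(\<Sum>v\<in>F. g (b v) (b v)) = 0"
    using a by (simp add: sum_distrib_left[symmetric])
  \<comment> \<open>A vanishing sum of non-negative terms vanishes termwise, so \<open>b\<close> is
    zero on the spanning set \<open>F\<close>.\<close>
  then have "g (b v) (b v) = 0" if "v \<in> F" for v
    using F that by (simp add: orthonormal_def sum_nonneg_eq_0_iff inner_product_nonneg[OF g])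
  then have "b v = 0" if "v \<in> F" for v
    using inner_product_pos[OF g, of "b v"] that by force
  then have "b x = 0" for x
    by (subst expandF[of x]) (simp add: linear_sum[OF lin_b] linear_scale[OF lin_b])
  then show thesis
    using that[of e] by (simp add: b_def)
qed

text \<open>The right identity makes \<open>L\<close> faithful, since \<open>L x = 0\<close> gives
  \<open>x = L x e = 0\<close>; hence \<open>hs_form\<close> is definite.\<close>

lemma invariant_inner_product:
  assumes "lie_algebra br" "unimodular br" "\<theta> a \<noteq> 0"
  obtains B where "inner_product B" and "\<And>x y z. B (br x y) z + B y (br x z) = 0"
proof -
  obtain e where e: "\<And>x. L x e = x"
    using right_identity[OF assms] by blast
  obtain E where E: "orthonormal g E" and expand: "\<And>x. x = (\<Sum>v\<in>E. g x v *\<^sub>R v)"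
    using orthonormal_basis_exists[OF g] by blast
  have "0 < hs_form E x x" if "x \<noteq> 0" for x
  proof -
    have "hs_form E x x \<noteq> 0"
      using hs_form_eq_0[OF _ expand, of x e] E e that by (auto simp: orthonormal_def)
    then show ?thesis
      using hs_form_nonneg[of E x] by simp
  qed
  then have "inner_product (hs_form E)"
    using bilinear_hs_form hs_form_sym by (auto simp: inner_product_def)
  then show thesis
    using that hs_form_invariant[OF E expand] by blast
qed

end

section \<open>Passing between LCP structures and the algebra, and pulling structures back\<close>

lemma conformally_flat_left_symmetric:
  assumes br: "lie_algebra br" and lcp: "conformally_flat_lcp_structure br g \<theta>"
  shows "conformal_left_symmetric br g \<theta> (weyl_connection br g \<theta>)"
proof -
  have g: "inner_product g" and closed: "closed_form br \<theta>"
    and rep: "lie_representation_on br UNIV (weyl_connection br g \<theta>)"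
    using lcp by (auto simp: conformally_flat_lcp_structure_def lcp_structure_def weyl_flat_def)
  note eq = weyl_connection_eq[OF br g closed_form_linear[OF closed]]
  note bil = inner_product_bilinear[OF g]
  show ?thesis
  proof
    show "inner_product g" by (fact g)
    show "bilinear (weyl_connection br g \<theta>)"
      using rep unfolding lie_representation_on_def bilinear_def
      by (auto intro!: linearI)
    \<comment> \<open>The Levi-Civita part is torsion-free, and the terms added to it are symmetric
      in x and y.\<close>
    show "weyl_connection br g \<theta> x y - weyl_connection br g \<theta> y x = br x y" for x y
    proof (rule inner_product_eqI[OF g])
      fix z
      show "g (weyl_connection br g \<theta> x y - weyl_connection br g \<theta> y x) z = g (br x y) z"
        using inner_product_sym[OF g, of x y]
        by (simp add: bilinear_lsub[OF bil] eq lie_algebra_antisym[OF br, of y x]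
            bilinear_lneg[OF bil] algebra_simps)
    qed
    \<comment> \<open>All terms are skew in y and z except \<open>\<theta> x *\<^sub>R y\<close>,
      which alone gives the right-hand side.\<close>
    show "g (weyl_connection br g \<theta> x y) z + g y (weyl_connection br g \<theta> x z)
        = 2 * \<theta> x * g y z" for x y z
      using inner_product_sym[OF g, of y z] inner_product_sym[OF g, of y "weyl_connection br g \<theta> x z"]
      by (simp add: eq lie_algebra_antisym[OF br, of z y] bilinear_lneg[OF bil] algebra_simps)
    show "weyl_connection br g \<theta> (br x y) z = weyl_connection br g \<theta> x (weyl_connection br g \<theta> y z)
        - weyl_connection br g \<theta> y (weyl_connection br g \<theta> x z)" for x y z
      using rep by (simp add: lie_representation_on_def)
  qed
qed

text \<open>By dimension \<open>\<phi>\<close> is an automorphism, and it intertwines the two Weyl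
  connections; injectivity then carries the representation laws back.\<close>

lemma conformally_flat_pullback:
  fixes br :: "'a::euclidean_space \<Rightarrow> 'a \<Rightarrow> 'a"
  assumes br: "lie_algebra br" and lcp: "conformally_flat_lcp_structure br g \<theta>"
    and \<phi>: "linear \<phi>" "inj \<phi>" and hom: "\<And>x y. \<phi> (br x y) = br (\<phi> x) (\<phi> y)"
    and closed': "closed_form br (\<lambda>x. \<theta> (\<phi> x))" and nz': "(\<lambda>x. \<theta> (\<phi> x)) \<noteq> (\<lambda>_. 0)"
  shows "conformally_flat_lcp_structure br (\<lambda>x y. g (\<phi> x) (\<phi> y)) (\<lambda>x. \<theta> (\<phi> x))"
proof -
  have g: "inner_product g" and closed: "closed_form br \<theta>"
    and rep: "lie_representation_on br UNIV (weyl_connection br g \<theta>)"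
    and nontriv: "(UNIV :: 'a set) \<noteq> {0}"
    using lcp by (auto simp: conformally_flat_lcp_structure_def lcp_structure_def weyl_flat_def)
  note bil = inner_product_bilinear[OF g]
  note \<phi>_simps = linear_add[OF \<phi>(1)] linear_scale[OF \<phi>(1)] linear_diff[OF \<phi>(1)]
  define g' where "g' x y = g (\<phi> x) (\<phi> y)" for x y
  define \<theta>' where "\<theta>' x = \<theta> (\<phi> x)" for x
  let ?W = "weyl_connection br g \<theta>" and ?W' = "weyl_connection br g' \<theta>'"
  have \<phi>_0: "\<phi> x \<noteq> 0" if "x \<noteq> 0" for x
    using that \<phi>(2) by (auto simp: linear_injective_0[OF \<phi>(1)])
  have g': "inner_product g'"
    unfolding inner_product_def
  proof (intro conjI allI impI)
    show "bilinear g'"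
      unfolding bilinear_def
      by (auto intro!: linearI simp: g'_def \<phi>_simps bilinear_ladd[OF bil] bilinear_radd[OF bil]
          bilinear_lmul[OF bil] bilinear_rmul[OF bil])
  qed (auto simp: g'_def inner_product_sym[OF g] intro!: inner_product_pos[OF g] \<phi>_0)
  have closed'': "closed_form br \<theta>'"
    using closed' by (simp add: \<theta>'_def[abs_def])
  note eq = weyl_connection_eq[OF br g closed_form_linear[OF closed]]
  note eq' = weyl_connection_eq[OF br g' closed_form_linear[OF closed'']]
  have surj: "surj \<phi>"
    using \<phi> by (rule linear_inj_imp_surj)
  \<comment> \<open>Surjectivity reduces the test vectors to \<open>\<phi> w\<close>, against which
    the defining formulas of both connections agree term by term.\<close>
  have W: "\<phi> (?W' x y) = ?W (\<phi> x) (\<phi> y)" for x y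
  proof (rule inner_product_eqI[OF g])
    fix z
    obtain w where w: "z = \<phi> w" using surj by blast
    show "g (\<phi> (?W' x y)) z = g (?W (\<phi> x) (\<phi> y)) z"
      using eq'[of x y w] by (simp add: eq w hom g'_def \<theta>'_def)
  qed
  have "lie_representation_on br UNIV ?W'"
    unfolding lie_representation_on_def
  proof (intro conjI allI ballI)
    show "?W' x (v + w) = ?W' x v + ?W' x w" for x v w
      by (rule injD[OF \<phi>(2)]) (use rep in \<open>simp add: W \<phi>_simps lie_representation_on_def\<close>)
    show "?W' x (c *\<^sub>R v) = c *\<^sub>R ?W' x v" for x c v
      by (rule injD[OF \<phi>(2)]) (use rep in \<open>simp add: W \<phi>_simps lie_representation_on_def\<close>)
    show "linear (\<lambda>x. ?W' x v)" for v
    proof -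
      have "linear (\<lambda>x. ?W x (\<phi> v))"
        using rep by (simp add: lie_representation_on_def)
      note W_simps = linear_add[OF this] linear_scale[OF this]
      show ?thesis
        by (rule linearI; rule injD[OF \<phi>(2)]) (simp_all add: W \<phi>_simps W_simps)
    qed
    show "?W' (br x y) v = ?W' x (?W' y v) - ?W' y (?W' x v)" for x y v
      by (rule injD[OF \<phi>(2)]) (use rep in \<open>simp add: W \<phi>_simps hom lie_representation_on_def\<close>)
  qed simp
  then have "conformally_flat_lcp_structure br g' \<theta>'"
    using g' closed'' nz' nontriv
    by (simp add: conformally_flat_lcp_structure_def lcp_structure_def weyl_flat_def \<theta>'_def[abs_def])
  then show ?thesis
    by (simp add: g'_def[abs_def] \<theta>'_def[abs_def])
qed

section \<open>Central vectors from an invariant inner product\<close>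

lemma invariant_sharp_central:
  assumes B: "inner_product B"
    and inv: "\<And>x y z. B (br x y) z + B y (br x z) = 0" and closed: "closed_form br \<theta>"
  shows "br x (sharp B \<theta>) = 0"
proof (rule inner_product_eqI[OF B])
  fix z
  \<comment> \<open>Invariance moves the bracket onto z, where the closed form kills it.\<close>
  show "B (br x (sharp B \<theta>)) z = B 0 z"
    using inv[of x "sharp B \<theta>" z] sharp_eq[OF B closed_form_linear[OF closed]]
    by (simp add: closed_form_bracket[OF closed] bilinear_lzero[OF inner_product_bilinear[OF B]])
qed

lemma central_vector_exists:
  assumes br: "lie_algebra br" and B: "inner_product B"
    and inv: "\<And>x y z. B (br x y) z + B y (br x z) = 0"
    and closed: "closed_form br \<theta>" "closed_form br \<theta>'"
    and nz: "\<theta> \<noteq> (\<lambda>_. 0)" "\<theta>' \<noteq> (\<lambda>_. 0)"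
  obtains c where "\<And>x. br x c = 0" and "\<theta> c = 1" and "\<theta>' c \<noteq> 0"
proof -
  have lin: "linear \<theta>" "linear \<theta>'" using closed closed_form_linear by auto
  have bil: "bilinear br" using br by (simp add: lie_algebra_def)
  note bilB = inner_product_bilinear[OF B]
  define t where "t = sharp B \<theta>"
  define t' where "t' = sharp B \<theta>'"
  have t: "B t z = \<theta> z" and t': "B t' z = \<theta>' z" for z
    using sharp_eq[OF B lin(1)] sharp_eq[OF B lin(2)] by (auto simp: t_def t'_def)
  have central: "br x t = 0" "br x t' = 0" for x
    unfolding t_def t'_def by (intro invariant_sharp_central[of B br, OF B inv] closed)+
  have "t \<noteq> 0"
    using nz(1) t by (auto simp: bilinear_lzero[OF bilB])
  moreover have "t' \<noteq> 0"
    using nz(2) t' by (auto simp: bilinear_lzero[OF bilB])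
  ultimately have pos: "0 < \<theta> t" "0 < \<theta>' t'"
    using inner_product_pos[OF B, of t] inner_product_pos[OF B, of t'] by (simp_all add: t t')
  have sym: "\<theta>' t = \<theta> t'"
    unfolding t[symmetric] t'[symmetric] by (rule inner_product_sym[OF B])
  \<comment> \<open>If \<open>\<theta>' t\<close> is non-zero, \<open>t\<close> itself serves.
    Otherwise \<open>sym\<close> makes both cross terms vanish, and \<open>t + t'\<close> has the
    positive values \<open>\<theta> t\<close> and \<open>\<theta>' t'\<close>.\<close>
  obtain d where d: "\<And>x. br x d = 0" "\<theta> d \<noteq> 0" "\<theta>' d \<noteq> 0"
  proof (cases "\<theta>' t = 0")
    case True
    then show thesis
      using that[of "t + t'"] pos sym central
      by (simp add: linear_add[OF lin(1)] linear_add[OF lin(2)] bilinear_radd[OF bil])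
  next
    case False
    then show thesis
      using that[of t] pos central by simp
  qed
  show thesis
    using that[of "(1 / \<theta> d) *\<^sub>R d"] d
    by (simp add: linear_scale[OF lin(1)] linear_scale[OF lin(2)] bilinear_rmul[OF bil])
qed

theorem proposition6p3:
  fixes br :: "'a::euclidean_space \<Rightarrow> 'a \<Rightarrow> 'a"
  assumes "lie_algebra br"
    and "unimodular br"
    and "\<exists>g \<theta>. conformally_flat_lcp_structure br g \<theta>"
  shows "\<forall>\<theta>. closed_form br \<theta> \<and> \<theta> \<noteq> (\<lambda>_. 0) \<longrightarrow>
           (\<exists>g. conformally_flat_lcp_structure br g \<theta>)"
proof (intro allI impI, elim conjE)
  fix \<theta>' assume closed': "closed_form br \<theta>'" and nz': "\<theta>' \<noteq> (\<lambda>_. 0)"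
  note br = \<open>lie_algebra br\<close>
  have bil_br: "bilinear br" using br by (simp add: lie_algebra_def)
  obtain g \<theta> where lcp: "conformally_flat_lcp_structure br g \<theta>"
    using assms(3) by blast
  then have closed: "closed_form br \<theta>" and nz: "\<theta> \<noteq> (\<lambda>_. 0)"
    by (auto simp: conformally_flat_lcp_structure_def lcp_structure_def)
  interpret conformal_left_symmetric br g \<theta> "weyl_connection br g \<theta>"
    using conformally_flat_left_symmetric[OF br lcp] .
  obtain a where "\<theta> a \<noteq> 0" using nz by blast
  obtain B where B: "inner_product B" and inv: "\<And>x y z. B (br x y) z + B y (br x z) = 0"
    by (rule invariant_inner_product[OF br \<open>unimodular br\<close> \<open>\<theta> a \<noteq> 0\<close>]) (rule that)
  obtain c where c: "\<And>x. br x c = 0" "\<theta> c = 1" "\<theta>' c \<noteq> 0"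
    by (rule central_vector_exists[of br B \<theta> \<theta>', OF br B inv closed closed' nz nz']) (rule that)
  have c': "br c x = 0" for x
    using c(1)[of x] lie_algebra_antisym[OF br, of c x] by simp
  note lin = closed_form_linear[OF closed] closed_form_linear[OF closed']
  \<comment> \<open>The normalisation \<open>\<theta> c = 1\<close> makes this shear turn
    \<open>\<theta>\<close> into \<open>\<theta>'\<close>. It preserves brackets because
    \<open>c\<close> is central and both forms kill brackets; its kernel lies in the line of
    \<open>c\<close> and is trivial because \<open>\<theta>' c\<close> is non-zero.\<close>
  define \<phi> where "\<phi> x = x + (\<theta>' x - \<theta> x) *\<^sub>R c" for x
  have \<theta>_\<phi>: "\<theta> (\<phi> x) = \<theta>' x" for x
    by (simp add: \<phi>_def linear_add[OF lin(1)] linear_scale[OF lin(1)] c)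
  have \<phi>: "linear \<phi>"
    by (rule linearI)
      (simp_all add: \<phi>_def linear_add[OF lin(1)] linear_scale[OF lin(1)]
        linear_add[OF lin(2)] linear_scale[OF lin(2)] algebra_simps)
  have "x = 0" if "\<phi> x = 0" for x
  proof -
    have "\<theta>' x = 0"
      using \<theta>_\<phi>[of x] that linear_0[OF lin(1)] by simp
    then have x: "x = \<theta> x *\<^sub>R c"
      using that by (simp add: \<phi>_def)
    then have "\<theta> x * \<theta>' c = 0"
      using \<open>\<theta>' x = 0\<close> linear_scale[OF lin(2), of "\<theta> x" c] by simp
    with x c(3) show ?thesis by simp
  qed
  then have "inj \<phi>"
    by (simp add: linear_injective_0[OF \<phi>])
  moreover have "\<phi> (br x y) = br (\<phi> x) (\<phi> y)" for x y
    by (simp add: \<phi>_def closed_form_bracket[OF closed] closed_form_bracket[OF closed']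
        bilinear_ladd[OF bil_br] bilinear_radd[OF bil_br] bilinear_lmul[OF bil_br]
        bilinear_rmul[OF bil_br] c c')
  ultimately have "conformally_flat_lcp_structure br (\<lambda>x y. g (\<phi> x) (\<phi> y)) (\<lambda>x. \<theta> (\<phi> x))"
    using closed' nz' by (intro conformally_flat_pullback[OF br lcp \<phi>]) (simp_all add: \<theta>_\<phi>)
  then show "\<exists>g. conformally_flat_lcp_structure br g \<theta>'"
    by (auto simp: \<theta>_\<phi>)
qed

end
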